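(* Let $K>\sigma>0$. There exists a $K$-subgaussian distribution $\mathbb{P}$ on $\mathbb{R}$ such that $I_{\chi^2}(S;Y)=\infty$, where $S\sim\mathbb{P}$ and $Z\sim\mathcal{N}(0,\sigma^2)$ are independent and $Y=S+Z$.
   Context: A probability distribution $\mathbb{P}$ on $\mathbb{R}$ is $K$-subgaussian if, for $X\sim\mathbb{P}$, $\mathbb{E}[e^{\lambda (X-\mathbb{E}[X])}]\le e^{\frac12K^2\lambda^2}$ for all $\lambda\in\mathbb{R}$. The $\chi^2$-mutual information is $I_{\chi^2}(S;Y)=\chi^2(P_{S,Y}\|P_S\otimes P_Y)$, where $\chi^2(P\|Q)=\int\left(\frac{dP}{dQ}\right)^2dQ-1$. *)

theory Defs
  imports "HOL-Probability.Probability"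
begin

text \<open>
  The exponential moments are nonnegative Lebesgue integrals, so that an infinite moment is not
  read as \<open>0\<close> and the bound forces them to be finite.
\<close>

definition subgaussian :: "real \<Rightarrow> real measure \<Rightarrow> bool" where
  "subgaussian K P \<longleftrightarrow>
     real_distribution P \<and> integrable P (\<lambda>x. x) \<and>
     (\<forall>l::real. (\<integral>\<^sup>+ x. ennreal (exp (l * (x - (\<integral>y. y \<partial>P)))) \<partial>P) \<le> ennreal (exp (K\<^sup>2 * l\<^sup>2 / 2)))"

text \<open>
  \<open>\<chi>\<^sup>2(P\<parallel>Q)\<close>, with the usual value \<open>\<infinity>\<close> when \<open>P\<close> is not absolutely continuous with respect
  to \<open>Q\<close>. Note that \<open>RN_deriv Q P\<close> is \<open>dP/dQ\<close>.
\<close>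

definition chi2_divergence :: "'a measure \<Rightarrow> 'a measure \<Rightarrow> ereal" where
  "chi2_divergence P Q =
     (if absolutely_continuous Q P
      then enn2ereal (\<integral>\<^sup>+ x. (RN_deriv Q P x)\<^sup>2 \<partial>Q) - 1
      else \<infinity>)"

definition chi2_mutual_information ::
    "'a measure \<Rightarrow> 'b measure \<Rightarrow> 'c measure \<Rightarrow> ('a \<Rightarrow> 'b) \<Rightarrow> ('a \<Rightarrow> 'c) \<Rightarrow> ereal" where
  "chi2_mutual_information M A B S Y =
     chi2_divergence (distr M (A \<Otimes>\<^sub>M B) (\<lambda>\<omega>. (S \<omega>, Y \<omega>))) (distr M A S \<Otimes>\<^sub>M distr M B Y)"

text \<open>The second argument of \<open>normal_density\<close> is the standard deviation, so \<open>Z\<close> has variance \<open>\<sigma>\<^sup>2\<close>.\<close>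

definition indep_signal_and_noise ::
    "real measure \<Rightarrow> real \<Rightarrow> 'a measure \<Rightarrow> ('a \<Rightarrow> real) \<Rightarrow> ('a \<Rightarrow> real) \<Rightarrow> bool" where
  "indep_signal_and_noise P \<sigma> M S Z \<longleftrightarrow>
     prob_space M \<and>
     S \<in> borel_measurable M \<and> distr M borel S = P \<and>
     distributed M lborel Z (\<lambda>z. ennreal (normal_density 0 \<sigma> z)) \<and>
     prob_space.indep_var M borel S borel Z"

end

theory Submission
  imports Defs "HOL-Real_Asymp.Real_Asymp"
begin

text \<open>
  The signal is discrete with atoms at \<open>0\<close> and at \<open>\<plusminus> r k\<close>, where \<open>r k = exp (k\<^sup>2)\<close> grows so fast that
  an atom is negligible compared with the next one. The atom \<open>r k\<close> has mass about
  \<open>2 ^ (- k) exp (- (r k)\<^sup>2 / (2 K\<^sup>2))\<close>, essentially the most that a \<open>K\<close>-subgaussian law can afford.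

  An observation \<open>Y \<ge> r k\<close> comes from a signal \<open>S \<ge> r k\<close>, whose probability is at most twice
  that of the atom, or from a smaller signal and a noise at least as large as the gap below \<open>r k\<close>. The gap is
  almost \<open>r k\<close>, so the second possibility has probability at most about \<open>exp (- (r k)\<^sup>2 / (2 \<sigma>\<^sup>2))\<close>. Since
  \<open>\<sigma> < K\<close>, this is much smaller than the mass of the atom
  (\<open>gaussian_gap_tail_eventually_le_atom\<close>). Thus an observation \<open>Y \<ge> r k\<close> identifies the atom with a
  probability bounded below, for each large \<open>k\<close>, and each such atom contributes a fixed positive amount
  to the \<open>\<chi>\<^sup>2\<close>-information, no matter how small its mass \<open>p\<close> is: on \<open>{r k} \<times> {r k..}\<close> the joint law has
  mass at least \<open>p / 2\<close> and the product law at most \<open>3 p\<^sup>2\<close>. Infinitely many atoms give an infinite value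
  (\<open>chi2_divergence_eq_top\<close>, \<open>chi2_mutual_information_eq_top\<close>).

  The law is arranged as a mixture of symmetric three-point laws. Its subgaussianity then reduces to
  an inequality for one such law (\<open>three_point_mgf_le\<close>, \<open>subgaussian_three_point_mixture\<close>).
\<close>

section \<open>Infinite divergence from infinitely many disjoint sets\<close>

text \<open>
  If \<open>P\<close> has a density with respect to \<open>Q\<close>, then by Cauchy--Schwarz
  \<open>P(D)\<^sup>2 \<le> Q(D) \<cdot> \<integral>\<^sub>D (dP/dQ)\<^sup>2 dQ\<close> for every measurable \<open>D\<close>. Infinitely many
  disjoint sets with \<open>P(D)\<^sup>2 / Q(D)\<close> bounded below therefore make the integral of \<open>(dP/dQ)\<^sup>2\<close>
  diverge, and no density has to be computed.
\<close>

lemma chi2_divergence_eq_top: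
  fixes D :: "nat \<Rightarrow> 'a set"
  assumes "finite_measure P" "finite_measure Q"
    and sets: "sets P = sets Q"
    and D: "\<And>k. D k \<in> sets Q" "disjoint_family D"
    and pos: "\<And>k. 0 < measure P (D k)"
    and \<epsilon>: "0 < \<epsilon>" "\<And>k. \<epsilon> * measure Q (D k) \<le> (measure P (D k))\<^sup>2"
  shows "chi2_divergence P Q = \<infinity>"
proof (cases "absolutely_continuous Q P")
  case True
  interpret P: finite_measure P by fact
  interpret Q: finite_measure Q by fact
  define f where "f = RN_deriv Q P"
  have [measurable]: "f \<in> borel_measurable Q" "\<And>k. D k \<in> sets Q"
    using D by (auto simp: f_def)
  have P_density: "P = density Q f"
    unfolding f_def using Q.density_RN_deriv[OF True sets] by simp
  have mass: "ennreal \<epsilon> \<le> (\<integral>\<^sup>+x. (f x)\<^sup>2 * indicator (D k) x \<partial>Q)" for k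
  proof -
    have "(emeasure P (D k))\<^sup>2 = (\<integral>\<^sup>+x. f x * indicator (D k) x * indicator (D k) x \<partial>Q)\<^sup>2"
      by (simp add: P_density emeasure_density mult.assoc flip: indicator_inter_arith)
    also have "\<dots> \<le> (\<integral>\<^sup>+x. (f x * indicator (D k) x)\<^sup>2 \<partial>Q) * (\<integral>\<^sup>+x. (indicator (D k) x)\<^sup>2 \<partial>Q)"
      by (rule Cauchy_Schwarz_nn_integral) auto
    also have "\<dots> = (\<integral>\<^sup>+x. (f x)\<^sup>2 * indicator (D k) x \<partial>Q) * emeasure Q (D k)"
      by (simp add: power_mult_distrib power2_eq_square[of "indicator _ _"] flip: indicator_inter_arith)
    finally have "ennreal ((measure P (D k))\<^sup>2)
        \<le> (\<integral>\<^sup>+x. (f x)\<^sup>2 * indicator (D k) x \<partial>Q) * ennreal (measure Q (D k))"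
      by (simp add: P.emeasure_eq_measure Q.emeasure_eq_measure ennreal_power)
    moreover have "ennreal \<epsilon> * ennreal (measure Q (D k)) \<le> ennreal ((measure P (D k))\<^sup>2)"
      using \<epsilon> by (simp flip: ennreal_mult)
    ultimately have "ennreal \<epsilon> * ennreal (measure Q (D k))
        \<le> (\<integral>\<^sup>+x. (f x)\<^sup>2 * indicator (D k) x \<partial>Q) * ennreal (measure Q (D k))"
      by (rule order_trans[rotated])
    moreover have "measure Q (D k) \<noteq> 0"
    proof
      assume "measure Q (D k) = 0"
      then have "D k \<in> null_sets Q"
        by (auto simp: null_sets_def Q.emeasure_eq_measure)
      then have "D k \<in> null_sets P"
        using True by (auto simp: absolutely_continuous_def)
      then show False
        using pos[of k] by (auto simp: null_sets_def P.emeasure_eq_measure)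
    qed
    ultimately show ?thesis
      by (simp add: mult.commute[of _ "ennreal (measure Q (D k))"] ennreal_mult_le_mult_iff
          zero_less_measure_iff)
  qed
  have bound: "of_nat n * ennreal \<epsilon> \<le> (\<integral>\<^sup>+x. (f x)\<^sup>2 \<partial>Q)" for n
  proof -
    have "of_nat n * ennreal \<epsilon> = (\<Sum>k<n. ennreal \<epsilon>)" by simp
    also have "\<dots> \<le> (\<Sum>k<n. \<integral>\<^sup>+x. (f x)\<^sup>2 * indicator (D k) x \<partial>Q)"
      by (intro sum_mono mass)
    also have "\<dots> = (\<integral>\<^sup>+x. (f x)\<^sup>2 * indicator (\<Union>k<n. D k) x \<partial>Q)"
      using D(2) by (simp add: nn_integral_sum[symmetric] sum_distrib_left[symmetric]
          indicator_UN_disjoint disjoint_family_on_def)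
    also have "\<dots> \<le> (\<integral>\<^sup>+x. (f x)\<^sup>2 \<partial>Q)"
      by (intro nn_integral_mono) (auto simp: indicator_def)
    finally show ?thesis .
  qed
  have "(\<integral>\<^sup>+x. (f x)\<^sup>2 \<partial>Q) = \<infinity>"
  proof (rule ccontr)
    assume "(\<integral>\<^sup>+x. (f x)\<^sup>2 \<partial>Q) \<noteq> \<infinity>"
    then obtain r where r: "0 \<le> r" "(\<integral>\<^sup>+x. (f x)\<^sup>2 \<partial>Q) = ennreal r"
      by (cases "\<integral>\<^sup>+x. (f x)\<^sup>2 \<partial>Q") auto
    obtain n where n: "r < real n * \<epsilon>"
      using reals_Archimedean3[OF \<epsilon>(1)] by blast
    have "ennreal (real n * \<epsilon>) \<le> ennreal r"
      using bound[of n] \<epsilon>(1) r by (simp add: ennreal_mult ennreal_of_nat_eq_real_of_nat)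
    then show False using n r(1) by (simp add: ennreal_le_iff)
  qed
  then show ?thesis
    using True by (simp add: chi2_divergence_def f_def)
qed (simp add: chi2_divergence_def)

section \<open>Tails of the Gaussian noise\<close>

text \<open>
  For \<open>t, w \<ge> 0\<close> the cross term of \<open>(t + w)\<^sup>2\<close> is nonnegative, so the density at \<open>t + w\<close> is at most
  \<open>exp (- t\<^sup>2 / (2 \<sigma>\<^sup>2))\<close> times the density at \<open>w\<close>. Integrating over \<open>w \<ge> 0\<close> gives the Chernoff bound
  without a moment generating function.
\<close>

lemma normal_upper_tail_le:
  fixes \<sigma> t :: real
  assumes \<sigma>: "0 < \<sigma>" and t: "0 \<le> t"
  shows "emeasure (density lborel (normal_density 0 \<sigma>)) {t..} \<le> ennreal (exp (- (t\<^sup>2 / (2 * \<sigma>\<^sup>2))))"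
proof -
  let ?N = "density lborel (normal_density 0 \<sigma>)"
  let ?e = "exp (- (t\<^sup>2 / (2 * \<sigma>\<^sup>2)))"
  interpret N: prob_space ?N by (rule prob_space_normal_density[OF \<sigma>])
  have shift: "normal_density 0 \<sigma> (t + w) \<le> ?e * normal_density 0 \<sigma> w" if "0 \<le> w" for w
  proof -
    have "- (t + w)\<^sup>2 / (2 * \<sigma>\<^sup>2) \<le> - (t\<^sup>2 / (2 * \<sigma>\<^sup>2)) + - w\<^sup>2 / (2 * \<sigma>\<^sup>2)"
      using \<sigma> t that by (simp add: power2_sum divide_simps)
    then have "exp (- (t + w)\<^sup>2 / (2 * \<sigma>\<^sup>2)) \<le> ?e * exp (- w\<^sup>2 / (2 * \<sigma>\<^sup>2))"
      by (simp flip: exp_add)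
    then show ?thesis
      using \<sigma> by (simp add: normal_density_def divide_right_mono)
  qed
  have "emeasure ?N {t..} = (\<integral>\<^sup>+x. ennreal (normal_density 0 \<sigma> x) * indicator {t..} x \<partial>lborel)"
    by (simp add: emeasure_density)
  also have "\<dots> = (\<integral>\<^sup>+w. ennreal (normal_density 0 \<sigma> (t + w)) * indicator {t..} (t + w) \<partial>lborel)"
    by (subst nn_integral_real_affine[where c=1 and t=t]) auto
  also have "\<dots> \<le> (\<integral>\<^sup>+w. ennreal ?e * (ennreal (normal_density 0 \<sigma> w) * indicator {0..} w) \<partial>lborel)"
    using shift by (intro nn_integral_mono)
      (auto simp: indicator_def ennreal_mult[symmetric] intro!: ennreal_leI)
  also have "\<dots> = ennreal ?e * emeasure ?N {0..}"
    by (simp add: nn_integral_cmult emeasure_density)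
  also have "\<dots> \<le> ennreal ?e * 1"
    by (intro mult_left_mono N.emeasure_le_1) auto
  finally show ?thesis by simp
qed

lemma normal_half_line_ge_half:
  fixes \<sigma> :: real
  assumes \<sigma>: "0 < \<sigma>"
  shows "1 / 2 \<le> measure (density lborel (normal_density 0 \<sigma>)) {0..}"
proof -
  let ?N = "density lborel (normal_density 0 \<sigma>)"
  interpret N: prob_space ?N by (rule prob_space_normal_density[OF \<sigma>])
  have even: "normal_density 0 \<sigma> (- x) = normal_density 0 \<sigma> x" for x
    by (simp add: normal_density_def)
  have "emeasure ?N {..0} = (\<integral>\<^sup>+x. ennreal (normal_density 0 \<sigma> x) * indicator {..0} x \<partial>lborel)"
    by (simp add: emeasure_density)
  also have "\<dots> = (\<integral>\<^sup>+x. ennreal (normal_density 0 \<sigma> (- x)) * indicator {..0} (- x) \<partial>lborel)"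
    by (subst nn_integral_real_affine[where c="-1" and t=0]) auto
  also have "\<dots> = emeasure ?N {0..}"
    by (auto simp: even emeasure_density indicator_def intro!: nn_integral_cong)
  finally have "emeasure ?N {..0} = emeasure ?N {0..}" .
  then have "measure ?N {..0} = measure ?N {0..}"
    by (simp add: measure_def)
  moreover have "measure ?N ({..0} \<union> {0..}) \<le> measure ?N {..0} + measure ?N {0..}"
    by (intro measure_Un_le) auto
  moreover have "{..0} \<union> {0..} = (UNIV :: real set)" by auto
  ultimately show ?thesis
    using N.prob_space by simp
qed

section \<open>A signal with well separated atoms\<close>

text \<open>
  The criterion is applied to \<open>D k = {r k} \<times> {r k..}\<close>. Write \<open>p\<close> for the mass of the atom \<open>r k\<close>. The
  joint law gives \<open>D k\<close> at least \<open>p / 2\<close>, since the noise is nonnegative with probability at least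
  one half. The product law gives \<open>D k\<close> exactly \<open>p\<close> times the probability that \<open>S + Z \<ge> r k\<close>. That
  event forces \<open>S \<ge> r k\<close>, which costs at most \<open>2 p\<close>, or a noise no smaller than the gap below \<open>r k\<close>,
  which costs at most \<open>p\<close>. Hence the ratio \<open>P(D)\<^sup>2 / Q(D)\<close> is at least \<open>(p / 2)\<^sup>2 / (3 p\<^sup>2) = 1 / 12\<close>.
\<close>

lemma chi2_mutual_information_eq_top:
  fixes r s :: "nat \<Rightarrow> real"
  assumes signal: "indep_signal_and_noise P \<sigma> M S Z" and \<sigma>: "0 < \<sigma>"
    and r: "inj r" and s: "\<And>k. s k \<le> r k"
    and gap: "\<And>k. AE x in P. x \<le> s k \<or> r k \<le> x"
    and right: "\<And>k. measure P {r k..} \<le> 2 * measure P {r k}"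
    and left: "\<And>k. exp (- ((r k - s k)\<^sup>2 / (2 * \<sigma>\<^sup>2))) \<le> measure P {r k}"
  shows "chi2_mutual_information M borel borel S (\<lambda>\<omega>. S \<omega> + Z \<omega>) = \<infinity>"
proof -
  let ?N = "density lborel (\<lambda>z. ennreal (normal_density 0 \<sigma> z))"
  let ?Y = "\<lambda>\<omega>. S \<omega> + Z \<omega>"
  let ?J = "distr M (borel \<Otimes>\<^sub>M borel) (\<lambda>\<omega>. (S \<omega>, ?Y \<omega>))"
  from signal have "prob_space M" and S[measurable]: "S \<in> borel_measurable M"
    and P: "distr M borel S = P"
    and Z: "distributed M lborel Z (\<lambda>z. ennreal (normal_density 0 \<sigma> z))"
    and indep: "prob_space.indep_var M borel S borel Z"
    by (auto simp: indep_signal_and_noise_def)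
  interpret prob_space M by fact
  have Z_meas[measurable]: "Z \<in> borel_measurable M"
    using distributed_measurable[OF Z] by simp
  have law_S: "prob (S -` A \<inter> space M) = measure P A" if "A \<in> sets borel" for A
    using that by (simp add: measure_distr flip: P)
  have law_Z: "prob (Z -` A \<inter> space M) = measure ?N A" if "A \<in> sets borel" for A
    using that distributed_distr_eq_density[OF Z] by (metis Z_meas measure_distr measurable_lborel1 sets_lborel)
  have tail: "prob (Z -` {t..} \<inter> space M) \<le> exp (- (t\<^sup>2 / (2 * \<sigma>\<^sup>2)))" if "0 \<le> t" for t
  proof -
    have "measure ?N {t..} \<le> exp (- (t\<^sup>2 / (2 * \<sigma>\<^sup>2)))"
      unfolding measure_def by (intro enn2real_leI normal_upper_tail_le \<sigma> that) simp
    then show ?thesis using law_Z[of "{t..}"] by simp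
  qed
  interpret S: prob_space "distr M borel S" by (rule prob_space_distr) simp
  interpret Y: prob_space "distr M borel ?Y" by (rule prob_space_distr) simp
  interpret J: prob_space ?J by (rule prob_space_distr) simp
  interpret SY: pair_prob_space "distr M borel S" "distr M borel ?Y" ..
  define D where "D k = {r k} \<times> {r k..}" for k
  have D_sets[measurable]: "D k \<in> sets (borel \<Otimes>\<^sub>M borel)" for k
    by (auto simp: D_def)
  have joint: "measure P {r k} / 2 \<le> measure ?J (D k)" for k
  proof -
    have "measure P {r k} * (1 / 2) \<le> measure P {r k} * measure ?N {0..}"
      by (intro mult_left_mono normal_half_line_ge_half \<sigma>) simp
    also have "\<dots> = prob ((\<lambda>\<omega>. (S \<omega>, Z \<omega>)) -` ({r k} \<times> {0..}) \<inter> space M)"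
      using law_S[of "{r k}"] law_Z[of "{0..}"] by (simp add: indep_varD[OF indep])
    also have "(\<lambda>\<omega>. (S \<omega>, Z \<omega>)) -` ({r k} \<times> {0..}) \<inter> space M
        = (\<lambda>\<omega>. (S \<omega>, ?Y \<omega>)) -` D k \<inter> space M"
      by (auto simp: D_def)
    also have "prob \<dots> = measure ?J (D k)"
      by (subst measure_distr) auto
    finally show ?thesis by simp
  qed
  have marginal: "measure (distr M borel ?Y) {r k..} \<le> 3 * measure P {r k}" for k
  proof -
    have "AE \<omega> in M. S \<omega> \<le> s k \<or> r k \<le> S \<omega>"
      using gap[of k] unfolding P[symmetric] by (subst (asm) AE_distr_iff) auto
    then have "prob (?Y -` {r k..} \<inter> space M)
        \<le> prob ((S -` {r k..} \<inter> space M) \<union> (Z -` {r k - s k..} \<inter> space M))"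
      by (intro finite_measure_mono_AE) auto
    also have "\<dots> \<le> measure P {r k..} + prob (Z -` {r k - s k..} \<inter> space M)"
      using law_S[of "{r k..}"] by (intro order_trans[OF measure_Un_le]) auto
    also have "\<dots> \<le> 2 * measure P {r k} + measure P {r k}"
      using tail[of "r k - s k"] s[of k] by (intro add_mono right order_trans[OF _ left]) auto
    finally show ?thesis by (simp add: measure_distr)
  qed
  have product: "measure (distr M borel S \<Otimes>\<^sub>M distr M borel ?Y) (D k) \<le> 3 * (measure P {r k})\<^sup>2" for k
  proof -
    have "measure (distr M borel S \<Otimes>\<^sub>M distr M borel ?Y) (D k)
        = measure P {r k} * measure (distr M borel ?Y) {r k..}"
      unfolding D_def P[symmetric]
      by (simp add: measure_def Y.emeasure_pair_measure_Times enn2real_mult)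
    also have "\<dots> \<le> measure P {r k} * (3 * measure P {r k})"
      by (intro mult_left_mono marginal) simp
    finally show ?thesis by (simp add: power2_eq_square)
  qed
  have "chi2_divergence ?J (distr M borel S \<Otimes>\<^sub>M distr M borel ?Y) = \<infinity>"
  proof (rule chi2_divergence_eq_top[where D=D and \<epsilon>="1/12"])
    show "disjoint_family D"
      using r by (auto simp: disjoint_family_on_def D_def inj_def)
    show "0 < measure ?J (D k)" for k
    proof -
      have "0 < measure P {r k}"
        by (rule less_le_trans[OF exp_gt_zero left])
      then show ?thesis
        using joint[of k] by linarith
    qed
    show "1 / 12 * measure (distr M borel S \<Otimes>\<^sub>M distr M borel ?Y) (D k) \<le> (measure ?J (D k))\<^sup>2" for k
    proof -
      have "(measure P {r k} / 2)\<^sup>2 \<le> (measure ?J (D k))\<^sup>2"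
        using joint by (intro power_mono) auto
      then show ?thesis using product[of k] by (simp add: power_divide)
    qed
  qed (auto intro: J.finite_measure_axioms SY.finite_measure_axioms)
  then show ?thesis by (simp add: chi2_mutual_information_def)
qed

text \<open>
  Independent signal and noise with the prescribed laws do exist, as the coordinates of the product
  space. So the statement about all such pairs is not vacuous.
\<close>

lemma indep_signal_and_noise_pair:
  assumes P: "real_distribution P" and \<sigma>: "0 < \<sigma>"
  shows "indep_signal_and_noise P \<sigma> (P \<Otimes>\<^sub>M density lborel (normal_density 0 \<sigma>)) fst snd"
proof -
  let ?N = "density lborel (\<lambda>z. ennreal (normal_density 0 \<sigma> z))"
  interpret P: real_distribution P by fact
  interpret N: prob_space ?N by (rule prob_space_normal_density[OF \<sigma>])
  interpret PN: pair_prob_space P ?N ..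
  have sets: "sets P = sets borel" "sets ?N = sets borel" by simp_all
  have meas: "fst \<in> borel_measurable (P \<Otimes>\<^sub>M ?N)" "snd \<in> borel_measurable (P \<Otimes>\<^sub>M ?N)"
    using measurable_fst measurable_snd measurable_cong_sets[OF refl sets(1)] measurable_cong_sets[OF refl sets(2)] by blast+
  have fst: "distr (P \<Otimes>\<^sub>M ?N) borel fst = P"
    using N.distr_pair_fst[of P] by (simp cong: distr_cong)
  have snd: "distr (P \<Otimes>\<^sub>M ?N) borel snd = ?N"
  proof (rule measure_eqI)
    fix A assume "A \<in> sets (distr (P \<Otimes>\<^sub>M ?N) borel snd)"
    then have A: "A \<in> sets borel" by simp
    have "snd -` A \<inter> space (P \<Otimes>\<^sub>M ?N) = UNIV \<times> A"
      by (auto simp: space_pair_measure)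
    then show "emeasure (distr (P \<Otimes>\<^sub>M ?N) borel snd) A = emeasure ?N A"
      using A P.emeasure_space_1 by (simp add: emeasure_distr meas N.emeasure_pair_measure_Times)
  qed simp
  have "distr (P \<Otimes>\<^sub>M ?N) (borel \<Otimes>\<^sub>M borel) (\<lambda>x. (fst x, snd x)) = P \<Otimes>\<^sub>M ?N"
    using distr_id2[of "borel \<Otimes>\<^sub>M borel" "P \<Otimes>\<^sub>M ?N"] sets_pair_measure_cong[OF sets(1,2)] by simp
  then have "PN.indep_var borel fst borel snd"
    using meas by (simp add: PN.indep_var_distribution_eq fst snd)
  moreover have "distributed (P \<Otimes>\<^sub>M ?N) lborel snd (\<lambda>z. ennreal (normal_density 0 \<sigma> z))"
    using meas(2) snd by (auto simp: distributed_def cong: distr_cong)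
  ultimately show ?thesis
    using meas fst PN.prob_space_axioms by (simp add: indep_signal_and_noise_def)
qed

section \<open>Subgaussian mixtures of symmetric three-point laws\<close>

text \<open>
  Comparison of the power series: every term after the constant one carries a factor \<open>u ^ (2 m)\<close>
  with \<open>m \<ge> 1\<close>, which is at most \<open>u\<^sup>2\<close>.
\<close>

lemma cosh_scale_le:
  fixes u t :: real
  assumes "\<bar>u\<bar> \<le> 1"
  shows "cosh (u * t) - 1 \<le> u\<^sup>2 * (cosh t - 1)"
proof -
  have u2: "u\<^sup>2 \<le> 1" using assms by (simp add: abs_square_le_1)
  let ?c = "\<lambda>x n. if even n then x ^ n /\<^sub>R fact n else (0::real)"
  have c: "?c x sums cosh x" for x by (rule cosh_converges)
  \<comment> \<open>The extra constant \<open>1 - u\<^sup>2\<close> makes the two series agree at \<open>n = 0\<close>.\<close>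
  have "(\<lambda>n. u\<^sup>2 * ?c t n + (if n = 0 then 1 - u\<^sup>2 else 0)) sums (u\<^sup>2 * cosh t + (1 - u\<^sup>2))"
    by (intro sums_add sums_mult c) (rule sums_single[where i=0 and f="\<lambda>_. 1 - u\<^sup>2"])
  moreover have "?c (u * t) n \<le> u\<^sup>2 * ?c t n + (if n = 0 then 1 - u\<^sup>2 else 0)" for n
  proof (cases "even n \<and> n \<noteq> 0")
    case True
    then obtain m where m: "n = 2 * Suc m" by (metis evenE mult_0_right not0_implies_Suc)
    have "u ^ n \<le> u\<^sup>2"
      using u2 power_decreasing[of 1 "Suc m" "u\<^sup>2"] unfolding m power_mult by simp
    moreover have "0 \<le> t ^ n / fact n" using True by (intro divide_nonneg_pos zero_le_even_power) auto
    ultimately have "u ^ n * (t ^ n / fact n) \<le> u\<^sup>2 * (t ^ n / fact n)"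
      by (rule mult_right_mono)
    then show ?thesis using True by (simp add: power_mult_distrib field_simps)
  qed auto
  ultimately have "cosh (u * t) \<le> u\<^sup>2 * cosh t + (1 - u\<^sup>2)"
    by (intro sums_le[OF _ c])
  then show ?thesis by (simp add: algebra_simps)
qed

text \<open>
  The left-hand side is the moment generating function at \<open>u\<close> of the symmetric law that puts total
  mass \<open>exp (- t\<^sup>2 / 2) / 4\<close> on \<open>{t, - t}\<close> and the rest at \<open>0\<close>. Completing the square gives
  \<open>exp (- t\<^sup>2 / 2) cosh (v t) \<le> exp (v\<^sup>2 / 2)\<close>. For \<open>\<bar>u\<bar> > 1\<close> this at \<open>v = u\<close> suffices, because
  then \<open>exp (u\<^sup>2 / 2) \<ge> 4 / 3\<close>, so that three quarters of it cover the summand \<open>1\<close> and the factor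
  \<open>1 / 4\<close> leaves the rest. For \<open>\<bar>u\<bar> \<le> 1\<close> the excess over \<open>1\<close> has to be of order \<open>u\<^sup>2\<close>, which
  the scaling bound for \<open>cosh\<close> provides, with \<open>v = 1\<close>.
\<close>

lemma three_point_mgf_le:
  fixes u t :: real
  shows "1 + exp (- (t\<^sup>2 / 2)) / 4 * (cosh (u * t) - 1) \<le> exp (u\<^sup>2 / 2)"
proof -
  have gauss: "exp (- (t\<^sup>2 / 2)) * cosh (v * t) \<le> exp (v\<^sup>2 / 2)" for v
  proof -
    have "- (t\<^sup>2 / 2) + v * t \<le> v\<^sup>2 / 2" "- (t\<^sup>2 / 2) + - (v * t) \<le> v\<^sup>2 / 2"
      using zero_le_power2[of "t - v"] zero_le_power2[of "t + v"]
      by (simp_all add: power2_eq_square algebra_simps)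
    then have "exp (- (t\<^sup>2 / 2)) * exp (v * t) \<le> exp (v\<^sup>2 / 2)"
      "exp (- (t\<^sup>2 / 2)) * exp (- (v * t)) \<le> exp (v\<^sup>2 / 2)"
      by (simp_all flip: exp_add)
    then show ?thesis by (simp add: cosh_def field_simps)
  qed
  show ?thesis
  proof (cases "\<bar>u\<bar> \<le> 1")
    case True
    have "exp (- (t\<^sup>2 / 2)) * (cosh (u * t) - 1) \<le> exp (- (t\<^sup>2 / 2)) * (u\<^sup>2 * cosh t)"
    proof (intro mult_left_mono)
      have "u\<^sup>2 * (cosh t - 1) \<le> u\<^sup>2 * cosh t" by (simp add: mult_left_mono)
      then show "cosh (u * t) - 1 \<le> u\<^sup>2 * cosh t" using cosh_scale_le[OF True, of t] by linarith
    qed simp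
    also have "\<dots> = u\<^sup>2 * (exp (- (t\<^sup>2 / 2)) * cosh t)" by simp
    also have "\<dots> \<le> u\<^sup>2 * 2"
    proof (rule mult_left_mono)
      have "exp (1 / 2 :: real) \<le> 2"
        using exp_bound_half[of "1/2 :: real"] by simp
      then show "exp (- (t\<^sup>2 / 2)) * cosh t \<le> 2" using gauss[of 1] by simp
    qed simp
    finally have "1 + exp (- (t\<^sup>2 / 2)) / 4 * (cosh (u * t) - 1) \<le> 1 + u\<^sup>2 / 2" by linarith
    also have "\<dots> \<le> exp (u\<^sup>2 / 2)" by (rule exp_ge_add_one_self)
    finally show ?thesis .
  next
    case False
    then have "1 < u\<^sup>2" by (simp add: abs_square_le_1 flip: not_le)
    then have "4 / 3 \<le> exp (u\<^sup>2 / 2)"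
      using exp_ge_add_one_self[of "u\<^sup>2 / 2"] by linarith
    moreover have "exp (- (t\<^sup>2 / 2)) * (cosh (u * t) - 1) \<le> exp (u\<^sup>2 / 2)"
      using gauss[of u] by (simp add: algebra_simps) (smt (verit) exp_gt_zero)
    ultimately show ?thesis by simp
  qed
qed

definition three_point :: "real \<Rightarrow> real \<Rightarrow> real pmf" where
  "three_point h a = bernoulli_pmf h \<bind> (\<lambda>b. if b then pmf_of_set {a, - a} else return_pmf 0)"

text \<open>
  The whole law is a mixture, over a geometrically distributed scale index \<open>k\<close>, of centred
  three-point laws that are each subgaussian with the same constant. A mixture of centred laws
  inherits a common bound on the moment generating functions, so subgaussianity needs to be proved
  for a single scale only. The Gaussian factor in the masses is the largest that the constant \<open>K\<close>
  allows, up to a constant factor.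
\<close>

definition three_point_mixture :: "real \<Rightarrow> (nat \<Rightarrow> real) \<Rightarrow> real pmf" where
  "three_point_mixture K r =
     geometric_pmf (1 / 2) \<bind> (\<lambda>k. three_point (exp (- ((r k / K)\<^sup>2 / 2)) / 4) (r k))"

lemma nn_integral_three_point:
  assumes "0 \<le> h" "h \<le> 1" "0 < a"
  shows "(\<integral>\<^sup>+x. f x \<partial>three_point h a)
    = ennreal (h / 2) * (f a + f (- a)) + ennreal (1 - h) * f 0"
proof -
  have "(f a + f (- a)) / 2 * ennreal h = ennreal (h / 2) * (f a + f (- a))"
    using assms by (simp add: ennreal_divide_times ennreal_times_divide mult.commute
        flip: divide_ennreal)
  then show ?thesis
    using assms by (simp add: three_point_def nn_integral_pmf_of_set mult.commute)
qed

lemma emeasure_three_point: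
  assumes "0 \<le> h" "h \<le> 1" "0 < a" "0 < t"
  shows "emeasure (three_point h a) {t} = (if t = a then ennreal (h / 2) else 0)"
    and "emeasure (three_point h a) {t..} = (if t \<le> a then ennreal (h / 2) else 0)"
  using assms nn_integral_three_point[OF assms(1-3), of "indicator {t}"]
    nn_integral_three_point[OF assms(1-3), of "indicator {t..}"] by auto

lemma map_uminus_three_point:
  assumes "0 < a"
  shows "map_pmf uminus (three_point h a) = three_point h a"
proof -
  have "map_pmf uminus (pmf_of_set {a, - a}) = pmf_of_set {a, - a}"
    by (subst map_pmf_of_set_inj) (auto simp: insert_commute)
  then show ?thesis
    unfolding three_point_def map_bind_pmf by (intro bind_pmf_cong) auto
qed

lemma three_point_mixture_mgf_le:
  assumes K: "0 < K" and r: "\<And>k. 0 < r k"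
  shows "(\<integral>\<^sup>+x. ennreal (exp (l * x)) \<partial>three_point_mixture K r) \<le> ennreal (exp (K\<^sup>2 * l\<^sup>2 / 2))"
proof -
  have "(\<integral>\<^sup>+x. ennreal (exp (l * x)) \<partial>three_point (exp (- ((r k / K)\<^sup>2 / 2)) / 4) (r k))
      \<le> ennreal (exp (K\<^sup>2 * l\<^sup>2 / 2))" for k
  proof -
    define h where "h = exp (- ((r k / K)\<^sup>2 / 2)) / 4"
    have h: "0 \<le> h" "h \<le> 1"
      by (auto simp: h_def intro: order_trans[of _ 1])
    have "(\<integral>\<^sup>+x. ennreal (exp (l * x)) \<partial>three_point h (r k))
        = ennreal (h / 2 * (exp (l * r k) + exp (l * - r k)) + (1 - h) * exp (l * 0))"
      using h by (simp add: nn_integral_three_point r flip: ennreal_plus)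
        (simp flip: ennreal_mult ennreal_plus)
    also have "h / 2 * (exp (l * r k) + exp (l * - r k)) + (1 - h) * exp (l * 0)
        = 1 + h * (cosh (K * l * (r k / K)) - 1)"
      using K by (simp add: cosh_def field_simps)
    also have "ennreal \<dots> \<le> ennreal (exp (K\<^sup>2 * l\<^sup>2 / 2))"
      using three_point_mgf_le[of "r k / K" "K * l"] unfolding h_def power_mult_distrib
      by (rule ennreal_leI)
    finally show ?thesis by (simp only: h_def)
  qed
  then have "(\<integral>\<^sup>+x. ennreal (exp (l * x)) \<partial>three_point_mixture K r)
      \<le> (\<integral>\<^sup>+k. ennreal (exp (K\<^sup>2 * l\<^sup>2 / 2)) \<partial>geometric_pmf (1/2))"
    unfolding three_point_mixture_def nn_integral_bind_pmf by (intro nn_integral_mono)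
  then show ?thesis by simp
qed

lemma subgaussian_three_point_mixture:
  assumes K: "0 < K" and r: "\<And>k. 0 < r k"
  shows "subgaussian K (distr (three_point_mixture K r) borel (\<lambda>x. x))"
proof -
  let ?p = "three_point_mixture K r"
  let ?P = "distr (measure_pmf ?p) borel (\<lambda>x. x)"
  have mgf: "(\<integral>\<^sup>+x. ennreal (exp (l * x)) \<partial>?P) \<le> ennreal (exp (K\<^sup>2 * l\<^sup>2 / 2))" for l
    using three_point_mixture_mgf_le[OF assms] by (simp add: nn_integral_distr)
  have "real_distribution ?P"
    by (auto simp: real_distribution_def real_distribution_axioms_def intro!: measure_pmf.prob_space_distr)
  moreover have "integrable ?P (\<lambda>x. x)"
  proof (rule integrableI_bounded)
    \<comment> \<open>\<open>\<bar>x\<bar>\<close> is dominated by the exponentials at \<open>l = 1\<close> and \<open>l = - 1\<close>.\<close>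
    have "(\<integral>\<^sup>+x. ennreal (norm x) \<partial>?P) \<le> (\<integral>\<^sup>+x. ennreal (exp (1 * x)) + ennreal (exp (-1 * x)) \<partial>?P)"
    proof (intro nn_integral_mono)
      fix x :: real
      have "norm x \<le> exp x + exp (- x)"
        unfolding real_norm_def
        using exp_ge_add_one_self[of x] exp_ge_add_one_self[of "- x"] exp_gt_zero[of x] exp_gt_zero[of "- x"]
        by linarith
      then show "ennreal (norm x) \<le> ennreal (exp (1 * x)) + ennreal (exp (-1 * x))"
        by (simp flip: ennreal_plus)
    qed
    also have "\<dots> = (\<integral>\<^sup>+x. ennreal (exp (1 * x)) \<partial>?P) + (\<integral>\<^sup>+x. ennreal (exp (-1 * x)) \<partial>?P)"
      by (intro nn_integral_add) auto
    also have "\<dots> \<le> ennreal (exp (K\<^sup>2 * 1\<^sup>2 / 2)) + ennreal (exp (K\<^sup>2 * (-1)\<^sup>2 / 2))"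
      by (intro add_mono mgf)
    also have "\<dots> < \<infinity>" by (simp flip: ennreal_plus)
    finally show "(\<integral>\<^sup>+x. ennreal (norm x) \<partial>?P) < \<infinity>" .
  qed simp
  \<comment> \<open>The law is symmetric, so its mean equals its own negative.\<close>
  moreover have "(\<integral>y. y \<partial>?P) = 0"
  proof -
    have "map_pmf uminus ?p = ?p"
      unfolding three_point_mixture_def map_bind_pmf by (simp add: map_uminus_three_point r)
    then have "measure_pmf.expectation ?p (\<lambda>x. x) = measure_pmf.expectation (map_pmf uminus ?p) (\<lambda>x. x)"
      by simp
    also have "\<dots> = - measure_pmf.expectation ?p (\<lambda>x. x)" by (subst integral_map_pmf) simp
    finally show ?thesis by (simp add: integral_distr)
  qed
  ultimately show ?thesis
    using mgf by (simp add: subgaussian_def)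
qed

section \<open>Atoms and tails of the mixture\<close>

lemma geometric_half_tail: "measure (geometric_pmf (1/2)) {k..} = (1 / 2) ^ k"
proof -
  have "(\<Sum>j<k. (1/2::real) ^ j * (1/2)) = 1 - (1 / 2) ^ k"
    by (induction k) (auto simp: field_simps)
  then have "measure (geometric_pmf (1/2)) {..<k} = 1 - (1 / 2) ^ k"
    by (simp add: measure_measure_pmf_finite)
  moreover have "measure (geometric_pmf (1/2)) (space (geometric_pmf (1/2)) - {..<k})
      = 1 - measure (geometric_pmf (1/2)) {..<k}"
    by (rule measure_pmf.prob_compl) simp
  moreover have "space (geometric_pmf (1/2)) - {..<k} = {k..}" by auto
  ultimately show ?thesis by simp
qed

lemma three_point_mixture_atom_ge:
  assumes r: "\<And>k. 0 < r k"
  shows "(1 / 2) ^ Suc k * (exp (- ((r k / K)\<^sup>2 / 2)) / 8) \<le> measure (three_point_mixture K r) {r k}"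
proof -
  let ?h = "\<lambda>k. exp (- ((r k / K)\<^sup>2 / 2)) / 4"
  have h: "0 \<le> ?h k" "?h k \<le> 1"
    by (auto intro: order_trans[of _ 1])
  have atom: "emeasure (three_point (?h k) (r k)) {r k} = ennreal (?h k / 2)"
    using emeasure_three_point(1)[OF h r r] by simp
  have "ennreal ((1 / 2) ^ Suc k * (exp (- ((r k / K)\<^sup>2 / 2)) / 8))
    = (\<integral>\<^sup>+j. ennreal (?h k / 2) * indicator {k} j \<partial>geometric_pmf (1/2))"
    by (subst nn_integral_cmult_indicator) (simp_all add: emeasure_pmf_single flip: ennreal_mult)
  also have "\<dots> \<le> (\<integral>\<^sup>+j. emeasure (three_point (?h j) (r j)) {r k} \<partial>geometric_pmf (1/2))"
    by (intro nn_integral_mono) (auto simp: indicator_def atom)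
  also have "\<dots> = emeasure (three_point_mixture K r) {r k}"
    by (simp add: three_point_mixture_def)
  finally show ?thesis
    by (simp add: measure_pmf.emeasure_eq_measure)
qed

text \<open>
  Only scales \<open>j \<ge> k\<close> reach \<open>{r k..}\<close>, and each does so with at most the conditional probability of
  the scale \<open>k\<close>, as the masses decrease. The geometric tail \<open>(1 / 2) ^ k\<close> is twice the weight
  \<open>(1 / 2) ^ Suc k\<close> of the index \<open>k\<close> itself. So everything from \<open>r k\<close> on has at most twice the mass
  of the atom \<open>r k\<close>.
\<close>

lemma three_point_mixture_tail_le:
  assumes K: "0 < K" and r: "\<And>k. 0 < r k" "strict_mono r"
  shows "measure (three_point_mixture K r) {r k..} \<le> (1 / 2) ^ k * (exp (- ((r k / K)\<^sup>2 / 2)) / 8)"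
proof -
  let ?h = "\<lambda>k. exp (- ((r k / K)\<^sup>2 / 2)) / 4"
  have h: "0 \<le> ?h k" "?h k \<le> 1" for k
    by (auto intro: order_trans[of _ 1])
  have tail: "emeasure (three_point (?h j) (r j)) {r k..} \<le> ennreal (?h k / 2) * indicator {k..} j" for j
  proof (cases "k \<le> j")
    case True
    then have "r k \<le> r j" using r(2) by (simp add: strict_mono_less_eq)
    have "emeasure (three_point (?h j) (r j)) {r k..} = ennreal (?h j / 2)"
      using emeasure_three_point(2)[OF h r(1) r(1), of j j k] \<open>r k \<le> r j\<close> by simp
    also have "\<dots> \<le> ennreal (?h k / 2)"
      using \<open>r k \<le> r j\<close> r(1)[of k] K by (intro ennreal_leI) (auto intro!: divide_right_mono power_mono)
    finally show ?thesis using True by simp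
  next
    case False
    then have "r j < r k" using r(2) by (simp add: strict_mono_less)
    then show ?thesis
      using emeasure_three_point(2)[OF h r(1) r(1), of j j k] by simp
  qed
  have "emeasure (three_point_mixture K r) {r k..}
      = (\<integral>\<^sup>+j. emeasure (three_point (?h j) (r j)) {r k..} \<partial>geometric_pmf (1/2))"
    by (simp add: three_point_mixture_def)
  also have "\<dots> \<le> (\<integral>\<^sup>+j. ennreal (?h k / 2) * indicator {k..} j \<partial>geometric_pmf (1/2))"
    by (intro nn_integral_mono tail)
  also have "\<dots> = ennreal ((1 / 2) ^ k * (exp (- ((r k / K)\<^sup>2 / 2)) / 8))"
    by (subst nn_integral_cmult_indicator)
      (simp_all add: measure_pmf.emeasure_eq_measure geometric_half_tail mult.commute flip: ennreal_mult)
  finally show ?thesis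
    by (simp add: measure_pmf.emeasure_eq_measure)
qed

lemma set_three_point_subset: "set_pmf (three_point h a) \<subseteq> {0, a, - a}"
proof -
  have "set_pmf (if b then pmf_of_set {a, - a} else return_pmf 0) \<subseteq> {0, a, - a}" for b
    by (cases b) auto
  then show ?thesis
    unfolding three_point_def set_bind_pmf by blast
qed

lemma set_three_point_mixture_subset:
  "set_pmf (three_point_mixture K r) \<subseteq> {0} \<union> range r \<union> range (\<lambda>k. - r k)"
proof -
  have "set_pmf (three_point h (r k)) \<subseteq> {0} \<union> range r \<union> range (\<lambda>k. - r k)" for h k
    by (rule order_trans[OF set_three_point_subset]) auto
  then show ?thesis
    unfolding three_point_mixture_def set_bind_pmf by (intro UN_least)
qed

section \<open>Infinite information with geometrically rare, rapidly growing scales\<close>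

text \<open>
  Here \<open>\<sigma> < K\<close> enters. The left-hand side bounds the probability that the noise bridges the gap from
  \<open>r k\<close> to \<open>r (Suc k)\<close>, and the right-hand side bounds the mass of the atom \<open>r (Suc k)\<close> from below.
  Because \<open>r k / r (Suc k) \<rightarrow> 0\<close>, the gap is asymptotically the whole of \<open>r (Suc k)\<close>. With
  \<open>a = 1 / (2 \<sigma>\<^sup>2)\<close> and \<open>b = 1 / (2 K\<^sup>2)\<close>, the exponents differ by about \<open>(a - b) (r (Suc k))\<^sup>2\<close>, which
  beats the logarithm of the geometric weight.
\<close>

lemma gaussian_gap_tail_eventually_le_atom:
  fixes \<sigma> K :: real
  assumes "0 < \<sigma>" "\<sigma> < K"
  defines "r \<equiv> \<lambda>k. exp ((real k)\<^sup>2)"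
  shows "eventually (\<lambda>k. exp (- ((r (Suc k) - r k)\<^sup>2 / (2 * \<sigma>\<^sup>2)))
           \<le> (1 / 2) ^ Suc (Suc k) * (exp (- ((r (Suc k) / K)\<^sup>2 / 2)) / 8)) sequentially"
proof -
  define a b where "a = 1 / (2 * \<sigma>\<^sup>2)" and "b = 1 / (2 * K\<^sup>2)"
  define d where "d = a - b"
  have "0 < d" "0 < a"
    using assms by (auto simp: a_def b_def d_def field_simps intro!: power_strict_mono)
  then have "filterlim (\<lambda>k. d * (exp ((real k + 1)\<^sup>2))\<^sup>2
      + a * ((exp ((real k + 1)\<^sup>2) - exp ((real k)\<^sup>2))\<^sup>2 - (exp ((real k + 1)\<^sup>2))\<^sup>2)
      - (real k + 5) * ln 2) at_top sequentially"
    by real_asymp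
  then have "eventually (\<lambda>k. 0 \<le> d * (exp ((real k + 1)\<^sup>2))\<^sup>2
      + a * ((exp ((real k + 1)\<^sup>2) - exp ((real k)\<^sup>2))\<^sup>2 - (exp ((real k + 1)\<^sup>2))\<^sup>2)
      - (real k + 5) * ln 2) sequentially"
    unfolding filterlim_at_top by blast
  then show ?thesis
  proof eventually_elim
    case (elim k)
    have two: "(1/2::real) ^ Suc (Suc k) / 8 = exp (- ((real k + 5) * ln 2))"
    proof -
      have "(1/2::real) ^ Suc (Suc k) / 8 = (1/2) ^ (k + 5)" by (simp add: power_add power_divide)
      also have "\<dots> = exp (ln ((1/2) ^ (k + 5)))" by simp
      also have "ln ((1/2::real) ^ (k + 5)) = - ((real k + 5) * ln 2)"
        by (subst ln_realpow) (auto simp: ln_div algebra_simps)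
      finally show ?thesis .
    qed
    have "(1 / 2) ^ Suc (Suc k) * (exp (- ((r (Suc k) / K)\<^sup>2 / 2)) / 8)
        = exp (- ((real k + 5) * ln 2) + - (b * (r (Suc k))\<^sup>2))"
      unfolding exp_add two[symmetric] by (simp add: b_def power_divide)
    moreover have "- ((r (Suc k) - r k)\<^sup>2 / (2 * \<sigma>\<^sup>2)) = - (a * (r (Suc k) - r k)\<^sup>2)"
      by (simp add: a_def)
    moreover have "r (Suc k) = exp ((real k + 1)\<^sup>2)" "r k = exp ((real k)\<^sup>2)"
      by (simp_all add: r_def add.commute)
    ultimately show ?case
      using elim by (simp add: d_def algebra_simps)
  qed
qed

lemma three_point_mixture_chi2_eq_top:
  fixes K \<sigma> :: real
  assumes "0 < \<sigma>" and "\<sigma> < K"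
  defines "r \<equiv> \<lambda>k. exp ((real k)\<^sup>2)"
  defines "P \<equiv> distr (three_point_mixture K r) borel (\<lambda>x. x)"
  assumes signal: "indep_signal_and_noise P \<sigma> M S Z"
  shows "chi2_mutual_information M borel borel S (\<lambda>\<omega>. S \<omega> + Z \<omega>) = \<infinity>"
proof -
  have K: "0 < K" using assms by simp
  have r: "0 < r k" "strict_mono r" for k
    by (auto simp: r_def strict_mono_def intro!: power_strict_mono)
  have measure_P: "measure P A = measure (three_point_mixture K r) A" if "A \<in> sets borel" for A
    using that by (simp add: P_def measure_distr)
  obtain n where n: "\<And>k. n \<le> k \<Longrightarrow> exp (- ((r (Suc k) - r k)\<^sup>2 / (2 * \<sigma>\<^sup>2)))
           \<le> (1 / 2) ^ Suc (Suc k) * (exp (- ((r (Suc k) / K)\<^sup>2 / 2)) / 8)"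
    using gaussian_gap_tail_eventually_le_atom[OF assms(1,2)] by (auto simp: eventually_sequentially r_def)
  \<comment> \<open>Beyond the scale \<open>n\<close>, each atom outweighs the noise that could carry a smaller signal up to it.\<close>
  show ?thesis
  proof (rule chi2_mutual_information_eq_top[where r="\<lambda>k. r (Suc (k + n))" and s="\<lambda>k. r (k + n)", OF signal assms(1)])
    fix k
    have atom: "(1 / 2) ^ Suc j * (exp (- ((r j / K)\<^sup>2 / 2)) / 8) \<le> measure P {r j}" for j
      using three_point_mixture_atom_ge[of r j K] r(1) by (simp add: measure_P)
    show "inj (\<lambda>k. r (Suc (k + n)))"
      using strict_mono_eq[OF r(2)] by (auto simp: inj_def)
    show "r (k + n) \<le> r (Suc (k + n))"
      using r(2) by (simp add: strict_mono_less_eq)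
    show "measure P {r (Suc (k + n))..} \<le> 2 * measure P {r (Suc (k + n))}"
      using three_point_mixture_tail_le[OF K r, of "Suc (k + n)"] atom[of "Suc (k + n)"]
      by (simp add: measure_P)
    show "exp (- ((r (Suc (k + n)) - r (k + n))\<^sup>2 / (2 * \<sigma>\<^sup>2))) \<le> measure P {r (Suc (k + n))}"
      by (rule order_trans[OF n atom]) simp
    show "AE x in P. x \<le> r (k + n) \<or> r (Suc (k + n)) \<le> x"
    proof -
      have "x \<le> r (k + n) \<or> r (Suc (k + n)) \<le> x" if "x \<in> set_pmf (three_point_mixture K r)" for x
      proof -
        from that have "x \<in> {0} \<union> range r \<union> range (\<lambda>k. - r k)"
          using set_three_point_mixture_subset by blast
        then consider "x = 0" | j where "x = r j" | j where "x = - r j"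
          by blast
        then show ?thesis
        proof cases
          case 1
          then show ?thesis using r(1)[of "k + n"] by linarith
        next
          case (2 j)
          then show ?thesis
            using strict_mono_less_eq[OF r(2), of j "k + n"]
              strict_mono_less_eq[OF r(2), of "Suc (k + n)" j] by linarith
        next
          case (3 j)
          then show ?thesis using r(1)[of "k + n"] r(1)[of j] by linarith
        qed
      qed
      then have "AE x in three_point_mixture K r. x \<le> r (k + n) \<or> r (Suc (k + n)) \<le> x"
        by (simp add: AE_measure_pmf_iff)
      then show ?thesis unfolding P_def by (subst AE_distr_iff) auto
    qed
  qed
qed

theorem proposition2:
  fixes K \<sigma> :: real
  assumes "K > \<sigma>" and "\<sigma> > 0"
  shows "\<exists>P :: real measure. subgaussian K P \<and>
    (\<exists>(M :: (real \<times> real) measure) S Z. indep_signal_and_noise P \<sigma> M S Z \<and>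
       chi2_mutual_information M borel borel S (\<lambda>\<omega>. S \<omega> + Z \<omega>) = \<infinity>) \<and>
    (\<forall>(M :: 'a measure) S Z. indep_signal_and_noise P \<sigma> M S Z \<longrightarrow>
       chi2_mutual_information M borel borel S (\<lambda>\<omega>. S \<omega> + Z \<omega>) = \<infinity>)"
proof -
  define P where "P = distr (three_point_mixture K (\<lambda>k. exp ((real k)\<^sup>2))) borel (\<lambda>x. x)"
  have P: "subgaussian K P"
    unfolding P_def using assms by (intro subgaussian_three_point_mixture) auto
  have "indep_signal_and_noise P \<sigma> (P \<Otimes>\<^sub>M density lborel (normal_density 0 \<sigma>)) fst snd"
    using P by (intro indep_signal_and_noise_pair assms) (simp add: subgaussian_def)
  moreover note infinite = three_point_mixture_chi2_eq_top[OF assms(2,1), folded P_def]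
  ultimately have "\<exists>(M :: (real \<times> real) measure) S Z. indep_signal_and_noise P \<sigma> M S Z \<and>
      chi2_mutual_information M borel borel S (\<lambda>\<omega>. S \<omega> + Z \<omega>) = \<infinity>"
    by blast
  moreover have "\<forall>(M :: 'a measure) S Z. indep_signal_and_noise P \<sigma> M S Z \<longrightarrow>
      chi2_mutual_information M borel borel S (\<lambda>\<omega>. S \<omega> + Z \<omega>) = \<infinity>"
    using infinite by blast
  ultimately show ?thesis
    using P by blast
qed

end
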